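(* Let $X,Y$ be separable metrizable spaces. If $|X|<\mathfrak b$, then each Borel function $f:X\to Y$ is $\bar\sigma$-continuous.
   Context: A function $f:X\to Y$ between topological spaces is called $\bar\sigma$-continuous if there exists a countable cover $\mathcal C$ of $X$ by closed subsets of $X$ such that for every $C\in\mathcal C$ the restriction $f{\restriction}C$ is continuous. A function is Borel if preimages of open sets are Borel sets. The cardinal $\mathfrak b$ is the smallest cardinality of a subset of $\omega^\omega$ (with the product topology, $\omega$ discrete) that is not contained in any $\sigma$-compact subset of $\omega^\omega$. *)

theory Defs
  imports "HOL-Analysis.Analysis"
begin

unbundle cardinal_syntax

definition borel_sets_of :: "'a topology \<Rightarrow> 'a set set" where
  "borel_sets_of X = sigma_sets (topspace X) {U. openin X U}"

definition borel_map :: "'a topology \<Rightarrow> 'b topology \<Rightarrow> ('a \<Rightarrow> 'b) \<Rightarrow> bool" where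
  "borel_map X Y f \<longleftrightarrow>
     f \<in> topspace X \<rightarrow> topspace Y \<and>
     (\<forall>V. openin Y V \<longrightarrow> {x \<in> topspace X. f x \<in> V} \<in> borel_sets_of X)"

definition sigma_bar_continuous_map :: "'a topology \<Rightarrow> 'b topology \<Rightarrow> ('a \<Rightarrow> 'b) \<Rightarrow> bool" where
  "sigma_bar_continuous_map X Y f \<longleftrightarrow>
     (\<exists>\<C>. countable \<C> \<and> (\<forall>C\<in>\<C>. closedin X C) \<and> \<Union>\<C> = topspace X \<and>
          (\<forall>C\<in>\<C>. continuous_map (subtopology X C) Y f))"

definition sigma_compactin :: "'a topology \<Rightarrow> 'a set \<Rightarrow> bool" where
  "sigma_compactin X S \<longleftrightarrow>
     (\<exists>\<K>. countable \<K> \<and> (\<forall>K\<in>\<K>. compactin X K) \<and> S = \<Union>\<K>)"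

definition baire_space :: "(nat \<Rightarrow> nat) topology" where
  "baire_space = product_topology (\<lambda>_. discrete_topology UNIV) UNIV"

definition sigma_bounded :: "(nat \<Rightarrow> nat) set \<Rightarrow> bool" where
  "sigma_bounded A \<longleftrightarrow> (\<exists>S. sigma_compactin baire_space S \<and> A \<subseteq> S)"

text \<open>
  Cardinals are represented by cardinal orders up to \<open>=o\<close>, so \<open>bfrak\<close> is the cardinal of
  some subset of least cardinality among those not contained in a \<open>\<sigma>\<close>-compact set. Such a
  subset exists, see \<open>bfrak_witness_exists\<close>, and \<open>bfrak\<close> is determined up to \<open>=o\<close>.
\<close>

definition bfrak :: "(nat \<Rightarrow> nat) rel" where
  "bfrak = |SOME A. \<not> sigma_bounded A \<and> (\<forall>B. \<not> sigma_bounded B \<longrightarrow> |A| \<le>o |B| )|"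

lemma not_sigma_bounded_UNIV: "\<not> sigma_bounded UNIV"
proof
  assume "sigma_bounded UNIV"
  then obtain \<K> where \<K>: "countable \<K>" "\<And>K. K \<in> \<K> \<Longrightarrow> compactin baire_space K" "\<Union>\<K> = UNIV"
    unfolding sigma_bounded_def sigma_compactin_def by (metis top.extremum_uniqueI)
  define k where "k = from_nat_into \<K>"
  have ne: "\<K> \<noteq> {}" using \<K>(3) by auto
  have fin: "finite ((\<lambda>x. x n) ` k n)" for n
  proof -
    have "compactin baire_space (k n)"
      using \<K>(2) ne by (simp add: k_def from_nat_into)
    moreover have "continuous_map baire_space (discrete_topology UNIV) (\<lambda>x. x n)"
      unfolding baire_space_def by (rule continuous_map_product_projection) simp
    ultimately have "compactin (discrete_topology UNIV) ((\<lambda>x. x n) ` k n)"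
      by (rule image_compactin)
    then show ?thesis by (simp add: compactin_discrete_topology)
  qed
  define g where "g n = Suc (Max ((\<lambda>x. x n) ` k n))" for n
  obtain n where "g \<in> k n"
    using \<K>(1,3) ne unfolding k_def by (metis UNIV_I UnionE from_nat_into_surj)
  then have "g n \<le> Max ((\<lambda>x. x n) ` k n)" using fin by (intro Max_ge) auto
  then show False by (simp add: g_def)
qed

lemma bfrak_witness_exists:
  "\<exists>A. \<not> sigma_bounded A \<and> (\<forall>B. \<not> sigma_bounded B \<longrightarrow> |A| \<le>o |B| )"
  using exists_minim_Card_order[of "card_of ` {A. \<not> sigma_bounded A}"] not_sigma_bounded_UNIV
  by (auto simp: card_of_Card_order)

lemma bfrak_least:
  shows "\<exists>A. \<not> sigma_bounded A \<and> bfrak = |A|"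
    and "\<not> sigma_bounded B \<Longrightarrow> bfrak \<le>o |B|"
  using someI_ex[OF bfrak_witness_exists] unfolding bfrak_def by blast+

end

theory Submission
  imports Defs
begin

text \<open>
  Call \<open>B \<subseteq> X\<close> ambiguous if \<open>B\<close> and its complement are both \<open>F\<^sub>\<sigma>\<close>. Given ambiguous sets
  \<open>B\<^sub>i = \<Union>\<^sub>m E\<^sub>i\<^sub>,\<^sub>m\<close> and \<open>X - B\<^sub>i = \<Union>\<^sub>m D\<^sub>i\<^sub>,\<^sub>m\<close> with increasing closed \<open>E\<^sub>i\<^sub>,\<^sub>m\<close> and \<open>D\<^sub>i\<^sub>,\<^sub>m\<close>, send
  \<open>x \<in> X\<close> to the function taking \<open>i\<close> to the least \<open>m\<close> with \<open>x \<in> E\<^sub>i\<^sub>,\<^sub>m \<union> D\<^sub>i\<^sub>,\<^sub>m\<close>. Since \<open>|X| < \<bb>\<close>, the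
  image is covered by countably many compact sets, each bounded by some \<open>g : \<omega> \<rightarrow> \<omega>\<close>. Hence \<open>X\<close>
  is covered by countably many closed sets \<open>\<Inter>\<^sub>i (E\<^sub>i\<^sub>,\<^sub>g\<^sub>(\<^sub>i\<^sub>) \<union> D\<^sub>i\<^sub>,\<^sub>g\<^sub>(\<^sub>i\<^sub>))\<close>, on each of which all \<open>B\<^sub>i\<close> are
  relatively clopen. It follows that the ambiguous sets form a \<open>\<sigma>\<close>-algebra containing the open
  sets, so every Borel set is ambiguous; applying the same covering to the preimages of a countable
  base of \<open>Y\<close> gives the theorem.
\<close>

text \<open>Balls of radius \<open>inverse (Suc n)\<close> around the points of a countable dense
  set form a base.\<close>

lemma metrizable_separable_imp_second_countable:
  assumes "metrizable_space Y" "separable_space Y"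
  shows "second_countable Y"
proof -
  obtain M d where M: "Metric_space M d" and Y: "Y = Metric_space.mtopology M d"
    using assms(1) unfolding metrizable_space_def by blast
  interpret Metric_space M d by (rule M)
  obtain C where C: "countable C" "C \<subseteq> M" "mtopology closure_of C = M"
    using assms(2) unfolding separable_space_def Y by auto
  define \<B> where "\<B> = (\<lambda>(c, n). mball c (inverse (Suc n))) ` (C \<times> (UNIV :: nat set))"
  have "\<exists>V\<in>\<B>. x \<in> V \<and> V \<subseteq> U" if U: "openin mtopology U" and x: "x \<in> U" for U x
  proof -
    obtain r where r: "r > 0" "mball x r \<subseteq> U" and "x \<in> M"
      using U x openin_mtopology by (meson subsetD)
    obtain n where n: "inverse (real (Suc n)) < r / 2"
      using reals_Archimedean[of "r / 2"] r by auto
    have "\<exists>c\<in>C. c \<in> mball x e" if "e > 0" for e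
      using C(3) \<open>x \<in> M\<close> that unfolding metric_closure_of by blast
    then obtain c where c: "c \<in> C" "c \<in> mball x (inverse (real (Suc n)))"
      by (meson inverse_positive_iff_positive of_nat_0_less_iff zero_less_Suc)
    then have "x \<in> mball c (inverse (real (Suc n)))"
      by (simp add: commute)
    moreover have "mball c (inverse (real (Suc n))) \<subseteq> mball x r"
    proof
      fix y assume y: "y \<in> mball c (inverse (real (Suc n)))"
      then have "d x y \<le> d x c + d c y"
        using c \<open>x \<in> M\<close> by (intro triangle) auto
      then show "y \<in> mball x r" using y c n by auto
    qed
    moreover have "mball c (inverse (real (Suc n))) \<in> \<B>"
      using c by (force simp: \<B>_def)
    ultimately show ?thesis using r by blast
  qed
  moreover have "countable \<B>" "\<forall>V\<in>\<B>. openin mtopology V"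
    using C by (auto simp: \<B>_def)
  ultimately show ?thesis unfolding second_countable_def Y by blast
qed

text \<open>Each coordinate projection of a compact set is compact in a discrete space, hence
  finite; the coordinatewise maxima dominate the compact set.\<close>

lemma sigma_bounded_imp_dominated:
  assumes "sigma_bounded A"
  obtains G :: "(nat \<Rightarrow> nat) set" where "countable G" "\<And>h. h \<in> A \<Longrightarrow> \<exists>g\<in>G. h \<le> g"
proof -
  obtain \<K> where \<K>: "countable \<K>" "\<And>K. K \<in> \<K> \<Longrightarrow> compactin baire_space K" "A \<subseteq> \<Union>\<K>"
    using assms unfolding sigma_bounded_def sigma_compactin_def by blast
  define g where "g K n = Max ((\<lambda>x. x n) ` K)" for K :: "(nat \<Rightarrow> nat) set" and n :: nat
  have "\<exists>g\<in>g ` \<K>. h \<le> g" if h: "h \<in> A" for h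
  proof -
    obtain K where K: "K \<in> \<K>" "h \<in> K" using \<K>(3) h by blast
    have "h n \<le> g K n" for n
    proof -
      have "continuous_map baire_space (discrete_topology UNIV) (\<lambda>x. x n)"
        unfolding baire_space_def by (rule continuous_map_product_projection) simp
      then have "compactin (discrete_topology UNIV) ((\<lambda>x. x n) ` K)"
        using \<K>(2) K(1) image_compactin by blast
      then show ?thesis
        using K(2) by (simp add: g_def compactin_discrete_topology)
    qed
    then show ?thesis using K(1) by (auto simp: le_fun_def)
  qed
  then show thesis using that[of "g ` \<K>"] \<K>(1) by blast
qed

text \<open>Being G-delta encodes that the complement is F-sigma, so the two assumptions on
  \<open>B i\<close> say that it is ambiguous.\<close>

lemma ambiguous_sets_closed_cover:
  fixes B :: "nat \<Rightarrow> 'a set"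
  assumes small: "|topspace X| <o bfrak"
    and B: "\<And>i. fsigma_in X (B i)" "\<And>i. gdelta_in X (B i)"
  obtains \<C> where "countable \<C>" "\<Union>\<C> = topspace X"
    "\<And>C. C \<in> \<C> \<Longrightarrow> closedin X C"
    "\<And>C i. C \<in> \<C> \<Longrightarrow> closedin X (C \<inter> B i)"
    "\<And>C i. C \<in> \<C> \<Longrightarrow> closedin X (C - B i)"
proof -
  obtain E where E: "\<And>i m. closedin X (E i m)" "\<And>i m. E i m \<subseteq> E i (Suc m)"
      "\<And>i. \<Union>(range (E i)) = B i"
    using B(1) unfolding fsigma_in_ascending by metis
  obtain D where D: "\<And>i m. closedin X (D i m)" "\<And>i m. D i m \<subseteq> D i (Suc m)"
      "\<And>i. \<Union>(range (D i)) = topspace X - B i"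
    using B(2) unfolding gdelta_in_fsigma_in fsigma_in_ascending by metis
  define F where "F i m = E i m \<union> D i m" for i m
  have F_closed: "closedin X (F i m)" for i m
    using E(1) D(1) by (simp add: F_def closedin_Un)
  \<comment> \<open>Monotonicity lets a bound \<open>h x \<le> g\<close> place \<open>x\<close> in
    every \<open>F i (g i)\<close>.\<close>
  have F_mono: "F i m \<subseteq> F i n" if "m \<le> n" for i m n
    using lift_Suc_mono_le[of "E i", OF E(2) that] lift_Suc_mono_le[of "D i", OF D(2) that]
    by (auto simp: F_def)
  define h where "h x i = (LEAST m. x \<in> F i m)" for x i
  have h: "x \<in> F i (h x i)" if "x \<in> topspace X" for x i
  proof -
    have "x \<in> (\<Union>m. E i m) \<or> x \<in> (\<Union>m. D i m)"
      using that E(3)[of i] D(3)[of i] by blast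
    then have "\<exists>m. x \<in> F i m" by (auto simp: F_def)
    then show ?thesis unfolding h_def by (rule LeastI_ex)
  qed
  have "sigma_bounded (h ` topspace X)"
  proof (rule ccontr)
    assume "\<not> sigma_bounded (h ` topspace X)"
    then have "bfrak \<le>o |h ` topspace X|" by (rule bfrak_least(2))
    also have "|h ` topspace X| \<le>o |topspace X|" by (rule card_of_image)
    finally show False using small not_ordLess_ordLeq by blast
  qed
  then obtain G where G: "countable G" "\<And>x. x \<in> topspace X \<Longrightarrow> \<exists>g\<in>G. h x \<le> g"
    by (rule sigma_bounded_imp_dominated) blast
  define c where "c g = (\<Inter>i. F i (g i))" for g
  have c_closed: "closedin X (c g)" for g
    unfolding c_def using F_closed by (intro closedin_Inter) auto
  \<comment> \<open>\<open>E i (g i)\<close> and \<open>D i (g i)\<close> lie on opposite sides of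
    \<open>B i\<close> and together cover \<open>c g\<close>.\<close>
  have cE: "c g \<inter> B i = c g \<inter> E i (g i)" and cD: "c g - B i = c g \<inter> D i (g i)" for g i
  proof -
    have "E i (g i) \<subseteq> B i" "D i (g i) \<inter> B i = {}" "c g \<subseteq> E i (g i) \<union> D i (g i)"
      using E(3)[of i] D(3)[of i] by (auto simp: c_def F_def)
    then show "c g \<inter> B i = c g \<inter> E i (g i)" "c g - B i = c g \<inter> D i (g i)" by blast+
  qed
  have "x \<in> \<Union>(c ` G)" if x: "x \<in> topspace X" for x
  proof -
    obtain g where g: "g \<in> G" "h x \<le> g" using G(2)[OF x] by blast
    have "x \<in> F i (g i)" for i using h[OF x] F_mono le_funD[OF g(2)] by blast
    then show ?thesis using g(1) by (auto simp: c_def)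
  qed
  then have "\<Union>(c ` G) = topspace X" using closedin_subset[OF c_closed] by blast
  moreover have "closedin X (C \<inter> B i)" "closedin X (C - B i)" if "C \<in> c ` G" for C i
    using that closedin_Int[OF c_closed E(1)] closedin_Int[OF c_closed D(1)] by (auto simp: cE cD)
  ultimately show thesis using that[of "c ` G"] G(1) c_closed by blast
qed

lemma borel_sets_ambiguous:
  assumes "metrizable_space X" and small: "|topspace X| <o bfrak"
    and "B \<in> borel_sets_of X"
  shows "fsigma_in X B \<and> gdelta_in X B"
  using assms(3) unfolding borel_sets_of_def
proof (induction rule: sigma_sets.induct)
  case (Basic U)
  then show ?case using assms(1) by (simp add: open_imp_fsigma_in open_imp_gdelta_in)
next
  case Empty
  show ?case by simp
next
  case (Compl B)
  then show ?case
    using fsigma_in_gdelta_in gdelta_in_fsigma_in by blast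
next
  case (Union B)
  obtain \<C> where \<C>: "countable \<C>" "\<Union>\<C> = topspace X"
    "\<And>C. C \<in> \<C> \<Longrightarrow> closedin X C" "\<And>C i. C \<in> \<C> \<Longrightarrow> closedin X (C - B i)"
    using ambiguous_sets_closed_cover[OF small, of B] Union.IH by metis
  have "fsigma_in X (\<Union>i. B i)"
    using Union.IH by (intro fsigma_in_Union) auto
  moreover have "fsigma_in X (topspace X - (\<Union>i. B i))"
  proof -
    \<comment> \<open>Cutting along the cover turns the complement, a countable intersection of
      F-sigma sets, into a countable union of closed sets.\<close>
    have "topspace X - (\<Union>i. B i) = (\<Union>C\<in>\<C>. \<Inter>i. C - B i)" using \<C>(2) by auto
    moreover have "closedin X (\<Inter>i. C - B i)" if "C \<in> \<C>" for C
      using \<C>(4)[OF that] by (intro closedin_Inter) auto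
    then have "fsigma_in X (\<Union>C\<in>\<C>. \<Inter>i. C - B i)"
      using \<C>(1) by (intro fsigma_in_Union) (auto intro: closed_imp_fsigma_in)
    ultimately show ?thesis by simp
  qed
  ultimately show ?case
    by (simp add: gdelta_in_fsigma_in fsigma_in_subset)
qed

theorem theorem1:
  fixes X :: "'a topology" and Y :: "'b topology" and f :: "'a \<Rightarrow> 'b"
  assumes "metrizable_space X" and "separable_space X"
    and "metrizable_space Y" and "separable_space Y"
    and "|topspace X| <o bfrak"
    and "borel_map X Y f"
  shows "sigma_bar_continuous_map X Y f"
proof -
  have f: "f \<in> topspace X \<rightarrow> topspace Y"
    "\<And>V. openin Y V \<Longrightarrow> {x \<in> topspace X. f x \<in> V} \<in> borel_sets_of X"
    using assms(6) by (auto simp: borel_map_def)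
  obtain \<B> where \<B>: "countable \<B>" "\<And>V. V \<in> \<B> \<Longrightarrow> openin Y V"
    "\<And>U y. openin Y U \<Longrightarrow> y \<in> U \<Longrightarrow> \<exists>V\<in>\<B>. y \<in> V \<and> V \<subseteq> U"
    using metrizable_separable_imp_second_countable[OF assms(3,4)]
    unfolding second_countable_def by metis
  \<comment> \<open>Adding the empty set makes the family nonempty, so that it can be enumerated
    even if \<open>\<B>\<close> is empty.\<close>
  define V where "V = from_nat_into (insert {} \<B>)"
  have V: "range V = insert {} \<B>"
    unfolding V_def using \<B>(1) by (intro range_from_nat_into) auto
  define P where "P i = {x \<in> topspace X. f x \<in> V i}" for i
  have "openin Y (V i)" for i
    using V \<B>(2) by (metis insertE openin_empty rangeI)
  then have "fsigma_in X (P i) \<and> gdelta_in X (P i)" for i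
    unfolding P_def using f(2) borel_sets_ambiguous[OF assms(1,5)] by blast
  then obtain \<C> where \<C>: "countable \<C>" "\<Union>\<C> = topspace X" "\<And>C. C \<in> \<C> \<Longrightarrow> closedin X C"
    "\<And>C i. C \<in> \<C> \<Longrightarrow> closedin X (C - P i)"
    using ambiguous_sets_closed_cover[OF assms(5), of P] by metis
  have "continuous_map (subtopology X C) Y f" if C: "C \<in> \<C>" for C
  proof -
    have sub: "C \<subseteq> topspace X" using C \<C>(2) by blast
    have top: "topspace (subtopology X C) = C" using sub by auto
    have "openin (subtopology X C) {x \<in> C. f x \<in> U}" if U: "openin Y U" for U
    proof -
      \<comment> \<open>Its complement in \<open>C\<close> is the closed set
        \<open>C - P i\<close>.\<close>
      have *: "openin (subtopology X C) (C \<inter> P i)" for i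
      proof -
        have "C \<inter> P i = C \<inter> (topspace X - (C - P i))" using sub by blast
        moreover have "openin X (topspace X - (C - P i))" using \<C>(4)[OF C] by blast
        ultimately show ?thesis by (metis openin_subtopology_Int2)
      qed
      have "{x \<in> C. f x \<in> U} = (\<Union>i\<in>{i. V i \<subseteq> U}. C \<inter> P i)"
      proof -
        have "\<exists>i. f x \<in> V i \<and> V i \<subseteq> U" if "f x \<in> U" for x
          using \<B>(3)[OF U that] V by (metis insertI2 rangeE)
        then show ?thesis using sub by (fastforce simp: P_def)
      qed
      moreover have "openin (subtopology X C) (\<Union>i\<in>{i. V i \<subseteq> U}. C \<inter> P i)"
        using * by (intro openin_Union) blast
      ultimately show ?thesis by (simp only:)
    qed
    then show ?thesis
      unfolding continuous_map_def top using f(1) sub by auto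
  qed
  then show ?thesis
    unfolding sigma_bar_continuous_map_def using \<C>(1-3) by (intro exI[of _ \<C>]) simp
qed

end
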